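(* Let $n\in\mathbb{N}$ and let $\mathbb{F}$ be an arbitrary field, either of characteristic zero or with $\operatorname{char}\mathbb{F}$ not dividing $n$. Consider the algebra $\mathrm{M}_n(\mathbb{F})$ with its canonical $C_n$-grading, and let $\mathcal{V}$ be a $C_n$-submodule of the trivial (neutral) component $(\mathrm{M}_n(\mathbb{F}))_1$, where $C_n$ acts by $\tau\cdot e_{ij}=e_{\tau(i),\tau(j)}$. Then there exists a multilinear polynomial in graded variables $f\in\mathbb{F}\langle X^{C_n}\rangle$ such that $\mathrm{Im}(f)=\mathcal{V}$, the image being taken on $\mathrm{M}_n(\mathbb{F})$ with the canonical grading.
   Context: $C_n=\langle\alpha\mid\alpha^n=1\rangle$ is the cyclic group of order $n$. $e_{ij}$ denotes the matrix unit with single nonzero entry $1$ in position $(i,j)$. The canonical (Vasilovsky) $C_n$-grading on $\mathrm{M}_n(\mathbb{F})$ is $\mathrm{M}_n(\mathbb{F})=\bigoplus_{\tau\in C_n}(\mathrm{M}_n(\mathbb{F}))_\tau$ with $(\mathrm{M}_n(\mathbb{F}))_\tau=\mathrm{Span}\{e_{ij}\mid\alpha^{i-j}=\tau\}$; in particular $(\mathrm{M}_n(\mathbb{F}))_1$ is the space of diagonal matrices. Identify $\alpha$ with the cycle $(1\ 2\ \cdots\ n)\in\mathcal{S}_n$, so $C_n\subseteq\mathcal{S}_n$ acts on $\{1,\ldots,n\}$; then $C_n$ acts linearly on $\mathrm{M}_n(\mathbb{F})$ by $\tau\cdot e_{ij}=e_{\tau(i),\tau(j)}$, and this action preserves each homogeneous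 component. The free $C_n$-graded associative algebra $\mathbb{F}\langle X^{C_n}\rangle$ is the free associative algebra on the variables $X^{C_n}=\{x_i^{(\tau)}\mid i\in\mathbb{N},\ \tau\in C_n\}$, where $x_i^{(\tau)}$ has homogeneous degree $\tau$. A polynomial $f(x_1^{(\tau_1)},\ldots,x_m^{(\tau_m)})$ is multilinear if it is a linear combination of monomials in which each of the variables $x_1^{(\tau_1)},\ldots,x_m^{(\tau_m)}$ appears exactly once. Its image on $\mathrm{M}_n(\mathbb{F})$ is $\mathrm{Im}(f)=\{f(a_1,\ldots,a_m)\mid a_i\in(\mathrm{M}_n(\mathbb{F}))_{\tau_i},\ i=1,\ldots,m\}$. *)

theory Defs
  imports
    "Jordan_Normal_Form.VS_Connect"
    "HOL-Algebra.Sym_Groups"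
    "HOL-Algebra.Generated_Groups"
    "HOL-Library.Poly_Mapping"
begin

section \<open>The cyclic group inside the symmetric group\<close>

definition cyc :: "nat \<Rightarrow> nat \<Rightarrow> nat" where
  "cyc n = cycle_of_list [1..<Suc n]"

definition cyclic_gp :: "nat \<Rightarrow> (nat \<Rightarrow> nat) monoid" where
  "cyclic_gp n = (sym_group n)\<lparr>carrier := generate (sym_group n) {cyc n}\<rparr>"


section \<open>The canonical grading of the matrix algebra\<close>

abbreviation mat_space :: "nat \<Rightarrow> ('a::field, 'a mat) module" where
  "mat_space n \<equiv> module_mat TYPE('a) n n"

text \<open>
  Rows and columns are numbered from 1 to \<open>n\<close>, as are the points permuted by
  \<^const>\<open>sym_group\<close>, whereas matrix indexing with \<open>$$\<close> starts at 0; hence the shifts by one.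
\<close>

definition mat_unit :: "nat \<Rightarrow> nat \<Rightarrow> nat \<Rightarrow> 'a::field mat" where
  "mat_unit n i j = mat n n (\<lambda>(r, c). if Suc r = i \<and> Suc c = j then 1 else 0)"

definition homogeneous_component :: "nat \<Rightarrow> (nat \<Rightarrow> nat) \<Rightarrow> 'a::field mat set" where
  "homogeneous_component n \<tau> =
     LinearCombinations.module.span class_ring (mat_space n)
       {mat_unit n i j | i j. i \<in> {1..n} \<and> j \<in> {1..n} \<and>
          cyc n [^]\<^bsub>cyclic_gp n\<^esub> (int i - int j) = \<tau>}"

abbreviation neutral_component :: "nat \<Rightarrow> 'a::field mat set" where
  "neutral_component n \<equiv> homogeneous_component n \<one>\<^bsub>cyclic_gp n\<^esub>"

text \<open>The linear extension of \<open>e\<^sub>i\<^sub>j \<mapsto> e\<^bsub>\<tau>(i) \<tau>(j)\<^esub>\<close>.\<close>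

definition perm_action :: "nat \<Rightarrow> (nat \<Rightarrow> nat) \<Rightarrow> 'a::field mat \<Rightarrow> 'a mat" where
  "perm_action n \<tau> A =
     (\<Oplus>\<^bsub>mat_space n\<^esub>p \<in> {1..n} \<times> {1..n}.
        case p of (i, j) \<Rightarrow> A $$ (i - 1, j - 1) \<cdot>\<^sub>m mat_unit n (\<tau> i) (\<tau> j))"

definition cyclic_submodule :: "nat \<Rightarrow> 'a::field mat set \<Rightarrow> 'a mat set \<Rightarrow> bool" where
  "cyclic_submodule n V W \<longleftrightarrow>
     V \<subseteq> W \<and> VectorSpace.subspace class_ring V (mat_space n) \<and>
     (\<forall>\<tau>\<in>carrier (cyclic_gp n). \<forall>A\<in>V. perm_action n \<tau> A \<in> V)"


section \<open>The free graded algebra\<close>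

datatype 'x monomial = Monomial (letters: "'x list")

instantiation monomial :: (type) monoid_add
begin

definition zero_monomial :: "'a monomial" where
  "0 = Monomial []"

definition plus_monomial :: "'a monomial \<Rightarrow> 'a monomial \<Rightarrow> 'a monomial" where
  "u + v = Monomial (letters u @ letters v)"

instance
  by standard (simp_all add: zero_monomial_def plus_monomial_def)

end

text \<open>
  The free monoid is written additively because the ring structure of
  \<^typ>\<open>'m \<Rightarrow>\<^sub>0 'a\<close> is the monoid algebra of an additive monoid \<^typ>\<open>'m\<close>; on the type below,
  \<open>*\<close> is therefore the product of noncommutative polynomials.
\<close>

type_synonym ('x, 'a) free_algebra = "'x monomial \<Rightarrow>\<^sub>0 'a"

text \<open>The pair \<open>(i, \<tau>)\<close> is the variable with index \<open>i\<close> and homogeneous degree \<open>\<tau>\<close>.\<close>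

type_synonym gvar = "nat \<times> (nat \<Rightarrow> nat)"

definition graded_vars :: "nat \<Rightarrow> gvar set" where
  "graded_vars n = UNIV \<times> carrier (cyclic_gp n)"

definition free_graded_algebra :: "nat \<Rightarrow> (gvar, 'a::field) free_algebra set" where
  "free_graded_algebra n = {f. \<forall>w\<in>Poly_Mapping.keys f. set (letters w) \<subseteq> graded_vars n}"

definition multilinear :: "nat \<Rightarrow> (nat \<Rightarrow> nat \<Rightarrow> nat) \<Rightarrow> (gvar, 'a::field) free_algebra \<Rightarrow> bool" where
  "multilinear m \<tau> f \<longleftrightarrow>
     (\<forall>w\<in>Poly_Mapping.keys f. distinct (letters w) \<and> set (letters w) = {(i, \<tau> i) | i. i \<in> {1..m}})"

definition evaluate_monomial :: "nat \<Rightarrow> ('x \<Rightarrow> 'a::field mat) \<Rightarrow> 'x monomial \<Rightarrow> 'a mat" where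
  "evaluate_monomial n a w = foldr (\<lambda>x P. a x * P) (letters w) (1\<^sub>m n)"

definition evaluate :: "nat \<Rightarrow> ('x \<Rightarrow> 'a::field mat) \<Rightarrow> ('x, 'a) free_algebra \<Rightarrow> 'a mat" where
  "evaluate n a f = (\<Oplus>\<^bsub>mat_space n\<^esub>w\<in>Poly_Mapping.keys f.
       Poly_Mapping.lookup f w \<cdot>\<^sub>m evaluate_monomial n a w)"

definition graded_image ::
    "nat \<Rightarrow> nat \<Rightarrow> (nat \<Rightarrow> nat \<Rightarrow> nat) \<Rightarrow> (gvar, 'a::field) free_algebra \<Rightarrow> 'a mat set" where
  "graded_image n m \<tau> f =
     {evaluate n a f | a. \<forall>i\<in>{1..m}. a (i, \<tau> i) \<in> homogeneous_component n (\<tau> i)}"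

end

theory Submission
  imports Defs
begin

text \<open>
  A diagonal matrix is an \<open>n\<close>-periodic sequence indexed by the integers, its \<open>r\<close>-th term being the
  diagonal entry in the position \<open>r mod n\<close>. The generator \<open>\<alpha>\<close> of the cyclic group then acts as the
  shift \<open>d \<mapsto> (\<lambda>r. d (r - 1))\<close>, so the submodules of the neutral component are the cyclic codes of
  length \<open>n\<close>, that is, the ideals of \<open>F[x]/(x\<^sup>n - 1)\<close>. Every such ideal is principal
  (\<open>cyclic_code_generator\<close>): there is a periodic \<open>v\<close> such that \<open>V\<close> consists of the cyclic
  convolutions of \<open>v\<close> with arbitrary periodic \<open>d\<close>.

  It remains to realise \<open>d \<mapsto> v * d\<close> by a multilinear polynomial. Take \<open>n\<close> variables, all of degree
  \<open>\<alpha>\<close>. A matrix of degree \<open>\<alpha>\<close> is a cyclic shift with arbitrary weights, so a product of \<open>n\<close> of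
  them is diagonal, and its \<open>r\<close>-th entry collects one weight of each factor along the closed walk
  \<open>r, r - 1, \<dots>, r - n\<close>. Starting the same walk \<open>k\<close> steps further gives the same factors in a
  cyclically rotated order; hence rotating the word \<open>x\<^sub>1 \<dots> x\<^sub>n\<close> cyclically only shifts its value
  (\<open>evaluate_word\<close>). The polynomial \<open>f = \<Sum>k<n. v k \<cdot> word k\<close>, in which \<open>word k\<close> is the rotated
  word whose value is that of \<open>x\<^sub>1 \<dots> x\<^sub>n\<close> shifted by \<open>k\<close>, therefore takes the value
  \<open>v * d\<close>, where \<open>d\<close> is the value of \<open>x\<^sub>1 \<dots> x\<^sub>n\<close>. Since \<open>d\<close> can be any periodic sequence
  (\<open>prod_seq_surj\<close>), the image of \<open>f\<close> is exactly \<open>V\<close>.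
\<close>

section \<open>Cyclic codes are principal\<close>

text \<open>
  The module structure over \<open>F[x]\<close> in which \<open>x\<close> is the shift by one. Working with polynomials
  rather than residue classes modulo \<open>x\<^sup>n - 1\<close> costs nothing, since \<open>x\<^sup>n - 1\<close> acts as zero
  on periodic sequences.
\<close>

definition poly_act :: "'a::field poly \<Rightarrow> (int \<Rightarrow> 'a) \<Rightarrow> int \<Rightarrow> 'a" where
  "poly_act p d r = (\<Sum>i\<le>degree p. coeff p i * d (r - int i))"

lemma poly_act_bound:
  assumes "degree p \<le> N"
  shows "poly_act p d r = (\<Sum>i\<le>N. coeff p i * d (r - int i))"
  unfolding poly_act_def
  by (rule sum.mono_neutral_left) (use assms in \<open>auto intro!: coeff_eq_0\<close>)

lemma poly_act_0 [simp]: "poly_act 0 d r = 0"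
  by (simp add: poly_act_def)

lemma poly_act_pCons [simp]: "poly_act (pCons a p) d r = a * d r + poly_act p d (r - 1)"
proof -
  have "poly_act (pCons a p) d r = (\<Sum>i\<le>Suc (degree p). coeff (pCons a p) i * d (r - int i))"
    by (rule poly_act_bound) (simp add: degree_pCons_le)
  also have "\<dots> = a * d r + (\<Sum>i\<le>degree p. coeff p i * d (r - 1 - int i))"
    by (subst sum.atMost_Suc_shift) (simp add: algebra_simps)
  finally show ?thesis
    by (simp add: poly_act_def)
qed

lemma poly_act_add: "poly_act (p + q) d r = poly_act p d r + poly_act q d r"
  by (induction p q arbitrary: r rule: poly_induct2) (simp_all add: algebra_simps)

lemma poly_act_smult: "poly_act (Polynomial.smult c p) d r = c * poly_act p d r"
  by (induction p arbitrary: r) (simp_all add: algebra_simps)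

lemma poly_act_mult: "poly_act (p * q) d r = poly_act p (poly_act q d) r"
  by (induction p arbitrary: r) (simp_all add: poly_act_add poly_act_smult mult_pCons_left)

lemma poly_act_sum: "poly_act (\<Sum>k\<in>K. p k) d r = (\<Sum>k\<in>K. poly_act (p k) d r)"
  by (induction K rule: infinite_finite_induct) (simp_all add: poly_act_add)

lemma poly_act_monom: "poly_act (monom a k) d r = a * d (r - int k)"
  by (induction k arbitrary: r) (simp_all add: monom_0 monom_Suc algebra_simps)

text \<open>
  Division with remainder by a nonzero element of least degree.
\<close>

lemma poly_ideal_principal:
  fixes I :: "'a::field poly set"
  assumes zero: "0 \<in> I"
    and add: "\<And>p q. p \<in> I \<Longrightarrow> q \<in> I \<Longrightarrow> p + q \<in> I"
    and mult: "\<And>p q. p \<in> I \<Longrightarrow> q * p \<in> I"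
  obtains g where "I = range (\<lambda>q. q * g)"
proof (cases "I = {0}")
  case True
  then show ?thesis
    using that[of 0] by auto
next
  case False
  then have ex: "\<exists>p. p \<in> I \<and> p \<noteq> 0"
    using zero by auto
  define g where "g = (ARG_MIN degree p. p \<in> I \<and> p \<noteq> 0)"
  have g: "g \<in> I" "g \<noteq> 0" and least: "\<And>p. p \<in> I \<Longrightarrow> p \<noteq> 0 \<Longrightarrow> degree g \<le> degree p"
    using ex arg_min_nat_lemma[of "\<lambda>p. p \<in> I \<and> p \<noteq> 0" _ degree] unfolding g_def by blast+
  have "p \<in> range (\<lambda>q. q * g)" if "p \<in> I" for p
  proof -
    have "p mod g = p + (- (p div g)) * g"
      by (simp add: minus_div_mult_eq_mod[symmetric])
    then have "p mod g \<in> I"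
      using add[OF that mult[OF g(1)]] by metis
    then have "p mod g = 0"
      using least[of "p mod g"] degree_mod_less'[OF g(2), of p] by linarith
    then show ?thesis
      by (metis div_mult_mod_eq add.right_neutral rangeI)
  qed
  then have "I = range (\<lambda>q. q * g)"
    using mult[OF g(1)] by blast
  then show ?thesis
    by (rule that)
qed

definition periodic :: "nat \<Rightarrow> (int \<Rightarrow> 'a) \<Rightarrow> bool" where
  "periodic n d \<longleftrightarrow> (\<forall>r. d (r mod int n) = d r)"

lemma periodic_cong: "periodic n d \<Longrightarrow> r mod int n = s mod int n \<Longrightarrow> d r = d s"
  by (metis periodic_def)

definition cyclic_conv :: "nat \<Rightarrow> (int \<Rightarrow> 'a::field) \<Rightarrow> (int \<Rightarrow> 'a) \<Rightarrow> int \<Rightarrow> 'a" where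
  "cyclic_conv n v d r = (\<Sum>k<n. v (int k) * d (r - int k))"

definition poly_of_seq :: "nat \<Rightarrow> (int \<Rightarrow> 'a::field) \<Rightarrow> 'a poly" where
  "poly_of_seq n d = (\<Sum>k<n. monom (d (int k)) k)"

lemma poly_act_poly_of_seq: "poly_act (poly_of_seq n v) d = cyclic_conv n v d"
  by (rule ext) (simp add: poly_of_seq_def poly_act_sum poly_act_monom cyclic_conv_def)

text \<open>
  The sequence of the matrix unit \<open>e\<^sub>1\<^sub>1\<close>, which corresponds to \<open>1\<close> in \<open>F[x]/(x\<^sup>n - 1)\<close>.
\<close>

definition delta_seq :: "nat \<Rightarrow> int \<Rightarrow> 'a::field" where
  "delta_seq n r = (if int n dvd r then 1 else 0)"

text \<open>
  This makes the map sending a polynomial \<open>p\<close> to \<open>p \<cdot> delta_seq n\<close> surjective onto the periodic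
  sequences, with \<open>poly_of_seq\<close> as a section.
\<close>

lemma cyclic_conv_delta_seq:
  assumes n: "n \<ge> 1" and d: "periodic n d"
  shows "cyclic_conv n d (delta_seq n) = d"
proof
  fix r
  let ?k = "nat (r mod int n)"
  have k: "int ?k = r mod int n" "?k < n"
    using n by (simp_all add: nat_less_iff)
  have dvd: "int n dvd r - int k \<longleftrightarrow> k = ?k" if "k < n" for k
    using that k(1) by (metis mod_eq_dvd_iff nat_int of_nat_mod mod_less)
  have "cyclic_conv n d (delta_seq n) r = (\<Sum>k<n. if k = ?k then d (int k) else 0)"
    unfolding cyclic_conv_def delta_seq_def by (rule sum.cong) (auto simp: dvd)
  also have "\<dots> = d (int ?k)"
    using k(2) by (simp add: sum.delta)
  also have "\<dots> = d r"
    using d k(1) by (simp add: periodic_def)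
  finally show "cyclic_conv n d (delta_seq n) r = d r" .
qed

lemma poly_act_mem:
  assumes zero: "(\<lambda>_. 0) \<in> W"
    and add: "\<And>d e. d \<in> W \<Longrightarrow> e \<in> W \<Longrightarrow> (\<lambda>r. d r + e r) \<in> W"
    and scale: "\<And>c d. d \<in> W \<Longrightarrow> (\<lambda>r. c * d r) \<in> W"
    and shift: "\<And>d. d \<in> W \<Longrightarrow> (\<lambda>r. d (r - 1)) \<in> W"
    and d: "d \<in> W"
  shows "poly_act p d \<in> W"
proof (induction p)
  case 0
  have "poly_act 0 d = (\<lambda>_. 0)"
    by (rule ext) simp
  then show ?case
    using zero by simp
next
  case (pCons a p)
  have "poly_act (pCons a p) d = (\<lambda>r. a * d r + poly_act p d (r - 1))"
    by (rule ext) simp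
  then show ?case
    using add[OF scale[OF d, of a] shift[OF pCons.IH]] by simp
qed

text \<open>
  Along the surjection \<open>\<Phi> p = p \<cdot> delta_seq n\<close> the code pulls back to an ideal of \<open>F[x]\<close>; if \<open>g\<close>
  generates that ideal, then \<open>v = \<Phi> g\<close> generates the code. That convolution with \<open>v\<close> is
  multiplication by \<open>g\<close> uses the commutativity of \<open>F[x]\<close>, which allows \<open>g\<close> to be exchanged for
  \<open>poly_of_seq n v\<close>, a polynomial with the same image under \<open>\<Phi>\<close>.
\<close>

theorem cyclic_code_generator:
  fixes W :: "(int \<Rightarrow> 'a::field) set"
  assumes n: "n \<ge> 1"
    and per: "\<And>d. d \<in> W \<Longrightarrow> periodic n d"
    and zero: "(\<lambda>_. 0) \<in> W"
    and add: "\<And>d e. d \<in> W \<Longrightarrow> e \<in> W \<Longrightarrow> (\<lambda>r. d r + e r) \<in> W"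
    and scale: "\<And>c d. d \<in> W \<Longrightarrow> (\<lambda>r. c * d r) \<in> W"
    and shift: "\<And>d. d \<in> W \<Longrightarrow> (\<lambda>r. d (r - 1)) \<in> W"
  obtains v where "W = {cyclic_conv n v d | d. periodic n d}"
proof -
  let ?\<Phi> = "\<lambda>p. poly_act p (delta_seq n :: int \<Rightarrow> 'a)"
  have \<Phi>_mult: "?\<Phi> (p * q) = poly_act p (?\<Phi> q)" for p q
    by (rule ext) (simp add: poly_act_mult)
  have \<Phi>_seq: "?\<Phi> (poly_of_seq n d) = d" if "periodic n d" for d
    using that n by (simp add: poly_act_poly_of_seq cyclic_conv_delta_seq)
  have \<Phi>_per: "periodic n (?\<Phi> p)" for p
  proof -
    have "int n dvd r mod int n - int i \<longleftrightarrow> int n dvd r - int i" for r i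
      by (simp only: dvd_eq_mod_eq_0 mod_diff_left_eq)
    then show ?thesis
      by (simp add: periodic_def poly_act_def delta_seq_def)
  qed
  have "0 \<in> {p. ?\<Phi> p \<in> W}"
    using zero by (simp add: poly_act_def[abs_def])
  moreover have "p + q \<in> {p. ?\<Phi> p \<in> W}" if "p \<in> {p. ?\<Phi> p \<in> W}" "q \<in> {p. ?\<Phi> p \<in> W}" for p q
  proof -
    have "?\<Phi> (p + q) = (\<lambda>r. ?\<Phi> p r + ?\<Phi> q r)"
      by (rule ext) (simp add: poly_act_add)
    then show ?thesis
      using that add[of "?\<Phi> p" "?\<Phi> q"] by simp
  qed
  moreover have "q * p \<in> {p. ?\<Phi> p \<in> W}" if "p \<in> {p. ?\<Phi> p \<in> W}" for p q
  proof -
    have "poly_act q (?\<Phi> p) \<in> W"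
      by (rule poly_act_mem) (use zero add scale shift that in \<open>simp_all only: mem_Collect_eq\<close>)
    then show ?thesis
      by (simp only: \<Phi>_mult mem_Collect_eq)
  qed
  ultimately obtain g where g: "{p. ?\<Phi> p \<in> W} = range (\<lambda>q. q * g)"
    by (rule poly_ideal_principal)
  define v where "v = ?\<Phi> g"
  have conv: "cyclic_conv n v (?\<Phi> q) = ?\<Phi> (q * g)" for q
  proof -
    have "cyclic_conv n v (?\<Phi> q) = ?\<Phi> (poly_of_seq n v * q)"
      by (simp add: \<Phi>_mult poly_act_poly_of_seq)
    also have "\<dots> = ?\<Phi> (q * poly_of_seq n v)"
      by (simp add: mult.commute)
    also have "\<dots> = ?\<Phi> (q * g)"
      using \<Phi>_seq[OF \<Phi>_per[of g]] by (simp add: \<Phi>_mult v_def)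
    finally show ?thesis .
  qed
  have "W = {cyclic_conv n v d | d. periodic n d}"
  proof (intro equalityI subsetI)
    fix w assume w: "w \<in> W"
    then have "poly_of_seq n w \<in> range (\<lambda>q. q * g)"
      using \<Phi>_seq[OF per[OF w]] by (simp flip: g)
    then obtain q where "poly_of_seq n w = q * g"
      by auto
    then have "w = cyclic_conv n v (?\<Phi> q)"
      using \<Phi>_seq[OF per[OF w]] conv by simp
    then show "w \<in> {cyclic_conv n v d | d. periodic n d}"
      using \<Phi>_per by blast
  next
    fix w assume "w \<in> {cyclic_conv n v d | d. periodic n d}"
    then obtain d where d: "periodic n d" "w = cyclic_conv n v d"
      by blast
    then have "w = ?\<Phi> (poly_of_seq n d * g)"
      using conv[of "poly_of_seq n d"] \<Phi>_seq by simp
    then show "w \<in> W"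
      using g by blast
  qed
  then show ?thesis
    by (rule that)
qed

section \<open>Powers of the cycle\<close>

text \<open>
  Integers serve as cyclic positions: \<open>r\<close> stands for the matrix index \<open>idx n r\<close>, and for the point
  \<open>Suc (idx n r)\<close> of the set \<open>{1..n}\<close> on which the cycle acts.
\<close>

definition idx :: "nat \<Rightarrow> int \<Rightarrow> nat" where
  "idx n r = nat (r mod int n)"

lemma idx_less [simp]: "n \<ge> 1 \<Longrightarrow> idx n r < n"
  by (simp add: idx_def nat_less_iff)

lemma idx_int [simp]: "i < n \<Longrightarrow> idx n (int i) = i"
  by (simp add: idx_def)

lemma int_idx: "n \<ge> 1 \<Longrightarrow> int (idx n r) = r mod int n"
  by (simp add: idx_def)

lemma idx_eq_iff: "n \<ge> 1 \<Longrightarrow> idx n r = idx n s \<longleftrightarrow> r mod int n = s mod int n"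
  by (metis int_idx of_nat_eq_iff)

lemma idx_idx_diff [simp]: "n \<ge> 1 \<Longrightarrow> idx n (int (idx n r) - s) = idx n (r - s)"
  by (simp add: idx_def mod_simps)

text \<open>
  A closed form for the \<open>k\<close>-th power of the cycle, for negative \<open>k\<close> too.
\<close>

definition rot :: "nat \<Rightarrow> int \<Rightarrow> nat \<Rightarrow> nat" where
  "rot n k x = (if x \<in> {1..n} then Suc (idx n (int x - 1 + k)) else x)"

lemma rot_Suc: "i < n \<Longrightarrow> rot n k (Suc i) = Suc (idx n (int i + k))"
  by (simp add: rot_def)

lemma rot_comp: "n \<ge> 1 \<Longrightarrow> rot n k \<circ> rot n l = rot n (k + l)"
  by (rule ext) (auto simp: rot_def idx_def Suc_le_eq nat_less_iff algebra_simps mod_simps)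

lemma rot_0: "rot n 0 = id"
proof
  fix x
  show "rot n 0 x = id x"
    by (cases x) (auto simp: rot_def)
qed

lemma rot_eq_iff: "n \<ge> 1 \<Longrightarrow> rot n k = rot n l \<longleftrightarrow> k mod int n = l mod int n"
proof
  assume n: "n \<ge> 1" and "rot n k = rot n l"
  then have "rot n k (Suc 0) = rot n l (Suc 0)"
    by simp
  then show "k mod int n = l mod int n"
    using n by (simp add: rot_def idx_eq_iff)
next
  assume n: "n \<ge> 1" and eq: "k mod int n = l mod int n"
  show "rot n k = rot n l"
    by (rule ext) (use n eq in \<open>auto simp: rot_def idx_eq_iff intro: mod_add_cong\<close>)
qed

lemma cyc_eq_rot: "cyc n = rot n 1"
proof
  fix x
  show "cyc n x = rot n 1 x"
  proof (cases "x \<in> {1..n}")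
    case False
    then have "x \<notin> set [1..<Suc n]"
      by auto
    then show ?thesis
      unfolding cyc_def rot_def using False id_outside_supp by metis
  next
    case True
    then obtain i where i: "x = Suc i" "i < n"
      by (cases x) auto
    have "map (cyc n) [1..<Suc n] = rotate 1 [1..<Suc n]"
      using cyclic_rotation[of "[1..<Suc n]" 1] by (simp add: cyc_def del: upt_Suc)
    then have "map (cyc n) [1..<Suc n] ! i = rotate 1 [1..<Suc n] ! i"
      by simp
    then have "cyc n x = 1 + (1 + i) mod n"
      using i by (simp add: nth_rotate del: upt_Suc rotate_Suc)
    also have "\<dots> = rot n 1 x"
      using i by (simp add: rot_Suc idx_def nat_mod_as_int add.commute)
    finally show ?thesis .
  qed
qed

lemma cyc_permutes: "cyc n permutes {1..n}"
  using cycle_permutes[of "[1..<Suc n]"] by (simp add: cyc_def atLeastLessThanSuc_atLeastAtMost del: upt_Suc)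

lemma cyclic_gp_group: "group (cyclic_gp n)"
proof -
  interpret S: group "sym_group n"
    by (rule sym_group_is_group)
  have "subgroup (generate (sym_group n) {cyc n}) (sym_group n)"
    by (rule S.generate_is_subgroup) (use cyc_permutes in \<open>auto simp: sym_group_carrier\<close>)
  then show ?thesis
    unfolding cyclic_gp_def by (rule S.subgroup_imp_group)
qed

lemma cyclic_gp_simps:
  "monoid.mult (cyclic_gp n) = (\<circ>)" "one (cyclic_gp n) = id" "cyc n \<in> carrier (cyclic_gp n)"
  by (auto simp: cyclic_gp_def sym_group_def intro: generate.incl)

lemma cyc_int_pow:
  assumes n: "n \<ge> 1"
  shows "cyc n [^]\<^bsub>cyclic_gp n\<^esub> (k::int) = rot n k"
proof -
  interpret G: group "cyclic_gp n"
    by (rule cyclic_gp_group)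
  have nat: "cyc n [^]\<^bsub>cyclic_gp n\<^esub> (m::nat) = rot n (int m)" for m
  proof (induction m)
    case 0
    show ?case
      by (simp add: cyclic_gp_simps rot_0)
  next
    case (Suc m)
    then show ?case
      using n by (simp add: cyclic_gp_simps cyc_eq_rot rot_comp add.commute)
  qed
  show ?thesis
  proof (cases "k \<ge> 0")
    case True
    then show ?thesis
      using nat[of "nat k"] by (metis int_pow_int nat_0_le)
  next
    case False
    let ?y = "cyc n [^]\<^bsub>cyclic_gp n\<^esub> k"
    \<comment> \<open>\<open>rot n (- k)\<close> is already known to be the \<open>- k\<close>-th power, and it is invertible as a function.\<close>
    have "?y \<otimes>\<^bsub>cyclic_gp n\<^esub> (cyc n [^]\<^bsub>cyclic_gp n\<^esub> (- k)) = \<one>\<^bsub>cyclic_gp n\<^esub>"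
      using G.int_pow_mult[of "cyc n" k "-k"] by (simp add: cyclic_gp_simps)
    moreover have "cyc n [^]\<^bsub>cyclic_gp n\<^esub> (- k) = rot n (- k)"
      using nat[of "nat (-k)"] False by (metis int_pow_int nat_0_le neg_0_le_iff_le nle_le)
    ultimately have "?y \<circ> rot n (- k) = id"
      by (simp add: cyclic_gp_simps)
    then have "?y \<circ> (rot n (- k) \<circ> rot n k) = rot n k"
      by (metis comp_assoc id_comp)
    then show ?thesis
      using n by (simp add: rot_comp rot_0)
  qed
qed

section \<open>Matrices supported on a homogeneous component\<close>

lemma mat_space_simps:
  "carrier (mat_space n :: ('a::field, 'a mat) module) = carrier_mat n n"
  "add (mat_space n :: ('a::field, 'a mat) module) = (+)"
  "zero (mat_space n :: ('a::field, 'a mat) module) = 0\<^sub>m n n"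
  "module.smult (mat_space n :: ('a::field, 'a mat) module) = (\<cdot>\<^sub>m)"
  by (simp_all add: module_mat_simps)

lemma finsum_mat_closed:
  fixes g :: "'x \<Rightarrow> 'a::field mat"
  assumes "\<And>x. x \<in> X \<Longrightarrow> g x \<in> carrier_mat n n"
  shows "(\<Oplus>\<^bsub>mat_space n\<^esub>x\<in>X. g x) \<in> carrier_mat n n"
proof -
  interpret abelian_group "mat_space n :: ('a, 'a mat) module"
    by (rule abelian_group_mat)
  show ?thesis
    using finsum_closed[of g X] assms by (auto simp: mat_space_simps)
qed

lemma finsum_mat_index:
  fixes g :: "'x \<Rightarrow> 'a::field mat"
  assumes "finite X" "\<And>x. x \<in> X \<Longrightarrow> g x \<in> carrier_mat n n" "i < n" "j < n"
  shows "(\<Oplus>\<^bsub>mat_space n\<^esub>x\<in>X. g x) $$ (i, j) = (\<Sum>x\<in>X. g x $$ (i, j))"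
  using assms(1,2)
proof (induction X)
  case empty
  interpret abelian_group "mat_space n :: ('a, 'a mat) module"
    by (rule abelian_group_mat)
  show ?case
    using assms(3,4) by (simp add: mat_space_simps)
next
  case (insert x X)
  interpret abelian_group "mat_space n :: ('a, 'a mat) module"
    by (rule abelian_group_mat)
  have "(\<Oplus>\<^bsub>mat_space n\<^esub>y\<in>insert x X. g y) = g x + (\<Oplus>\<^bsub>mat_space n\<^esub>y\<in>X. g y)"
    using insert by (subst finsum_insert) (auto simp: mat_space_simps)
  then show ?case
    using insert finsum_mat_closed[of X g n] assms(3,4) by (auto simp: index_add_mat)
qed

lemma mat_unit_carrier [simp]: "mat_unit n i j \<in> carrier_mat n n"
  by (simp add: mat_unit_def)

lemma mat_unit_index:
  "r < n \<Longrightarrow> c < n \<Longrightarrow> mat_unit n i j $$ (r, c) = (if Suc r = i \<and> Suc c = j then 1 else 0)"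
  by (simp add: mat_unit_def)

text \<open>
  The span of a set of matrix units is described by its zero pattern. This turns membership in a
  homogeneous component into a condition on entries.
\<close>

lemma span_mat_unit:
  fixes A :: "'a::field mat"
  shows "A \<in> LinearCombinations.module.span class_ring (mat_space n)
      {mat_unit n i j | i j. i \<in> {1..n} \<and> j \<in> {1..n} \<and> P i j}
    \<longleftrightarrow> A \<in> carrier_mat n n \<and> (\<forall>r<n. \<forall>c<n. A $$ (r, c) \<noteq> 0 \<longrightarrow> P (Suc r) (Suc c))"
proof -
  let ?S = "{mat_unit n i j :: 'a mat | i j. i \<in> {1..n} \<and> j \<in> {1..n} \<and> P i j}"
  let ?N = "{A :: 'a mat. A \<in> carrier_mat n n \<and> (\<forall>r<n. \<forall>c<n. \<not> P (Suc r) (Suc c) \<longrightarrow> A $$ (r, c) = 0)}"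
  interpret vs: matrix_vs n n "TYPE('a)" .
  have S: "?S \<subseteq> carrier_mat n n"
    by auto
  have sub: "submodule class_ring ?N (mat_space n)"
    by (rule submodule.intro)
      (use matrix_vs in \<open>auto simp: vectorspace_def mat_space_simps\<close>)
  have "?S \<subseteq> ?N"
    by (auto simp: mat_unit_index split: if_splits)
  then have "vs.span ?S \<subseteq> ?N"
    using sub by (rule vs.span_is_subset)
  moreover have "A \<in> vs.span ?S" if A: "A \<in> ?N"
  proof -
    have sp: "submodule class_ring (vs.span ?S) (mat_space n)"
      using S by (rule vs.span_is_submodule)
    let ?T = "\<lambda>p. A $$ (fst p, snd p) \<cdot>\<^sub>m mat_unit n (Suc (fst p)) (Suc (snd p))"
    have T: "?T p \<in> vs.span ?S" if "p \<in> {..<n} \<times> {..<n}" for p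
    proof (cases "A $$ (fst p, snd p) = 0")
      case True
      have "?T p = 0\<^sub>m n n"
        by (rule eq_matI) (use True in \<open>auto simp: mat_unit_def\<close>)
      then show ?thesis
        using submodule.zero_closed[OF sp] by (simp add: mat_space_simps)
    next
      case False
      then have "mat_unit n (Suc (fst p)) (Suc (snd p)) \<in> ?S"
        using that A by fastforce
      then have "mat_unit n (Suc (fst p)) (Suc (snd p)) \<in> vs.span ?S"
        using vs.in_own_span[of ?S] S by blast
      then show ?thesis
        using submodule.smult_closed[OF sp] by (simp add: mat_space_simps)
    qed
    have "(\<Oplus>\<^bsub>mat_space n\<^esub>p\<in>X. ?T p) \<in> vs.span ?S" if "finite X" "X \<subseteq> {..<n} \<times> {..<n}" for X
      using that
    proof (induction X)
      case empty
      show ?case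
        using submodule.zero_closed[OF sp] by (simp add: mat_space_simps)
    next
      case (insert x X)
      have "(\<Oplus>\<^bsub>mat_space n\<^esub>p\<in>insert x X. ?T p) = ?T x + (\<Oplus>\<^bsub>mat_space n\<^esub>p\<in>X. ?T p)"
        using insert by (subst vs.finsum_insert) (auto simp: mat_space_simps)
      then show ?case
        using insert T[of x] submodule.m_closed[OF sp] by (simp add: mat_space_simps)
    qed
    then have "(\<Oplus>\<^bsub>mat_space n\<^esub>p\<in>{..<n} \<times> {..<n}. ?T p) \<in> vs.span ?S"
      by simp
    moreover have "(\<Oplus>\<^bsub>mat_space n\<^esub>p\<in>{..<n} \<times> {..<n}. ?T p) = A"
    proof (rule eq_matI)
      fix r c assume "r < dim_row A" "c < dim_col A"
      then have rc: "r < n" "c < n"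
        using A by auto
      have "(\<Oplus>\<^bsub>mat_space n\<^esub>p\<in>{..<n} \<times> {..<n}. ?T p) $$ (r, c)
          = (\<Sum>p\<in>{..<n} \<times> {..<n}. ?T p $$ (r, c))"
        using rc by (intro finsum_mat_index) auto
      also have "\<dots> = (\<Sum>p\<in>{..<n} \<times> {..<n}. if p = (r, c) then A $$ (r, c) else 0)"
        by (rule sum.cong) (use rc in \<open>auto simp: mat_unit_def\<close>)
      also have "\<dots> = A $$ (r, c)"
        using rc by (simp add: sum.delta)
      finally show "(\<Oplus>\<^bsub>mat_space n\<^esub>p\<in>{..<n} \<times> {..<n}. ?T p) $$ (r, c) = A $$ (r, c)" .
    next
      have S: "(\<Oplus>\<^bsub>mat_space n\<^esub>p\<in>{..<n} \<times> {..<n}. ?T p) \<in> carrier_mat n n"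
        by (rule finsum_mat_closed) auto
      have A': "A \<in> carrier_mat n n"
        using A by simp
      show "dim_row (\<Oplus>\<^bsub>mat_space n\<^esub>p\<in>{..<n} \<times> {..<n}. ?T p) = dim_row A"
        "dim_col (\<Oplus>\<^bsub>mat_space n\<^esub>p\<in>{..<n} \<times> {..<n}. ?T p) = dim_col A"
        by (simp_all only: carrier_matD[OF S] carrier_matD[OF A'])
    qed
    ultimately show ?thesis
      by simp
  qed
  ultimately show ?thesis
    by blast
qed

text \<open>
  The nonzero entries \<open>(r, c)\<close> in degree \<open>\<alpha>\<^sup>k\<close> satisfy \<open>r - c = k\<close> modulo \<open>n\<close>, so each row has
  at most one of them.
\<close>

lemma homogeneous_component_rot:
  assumes n: "n \<ge> 1"
  shows "A \<in> homogeneous_component n (rot n k) \<longleftrightarrow>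
    A \<in> carrier_mat n n \<and> (\<forall>r<n. \<forall>c<n. A $$ (r, c) \<noteq> 0 \<longrightarrow> c = idx n (int r - k))"
proof -
  have "rot n (int (Suc r) - int (Suc c)) = rot n k \<longleftrightarrow> c = idx n (int r - k)"
    if "r < n" "c < n" for r c
  proof -
    have "c = idx n (int r - k) \<longleftrightarrow> idx n (int c) = idx n (int r - k)"
      using that by simp
    also have "\<dots> \<longleftrightarrow> int n dvd int c - (int r - k)"
      using n by (simp only: idx_eq_iff mod_eq_dvd_iff)
    also have "\<dots> \<longleftrightarrow> int n dvd (int r - int c) - k"
      by (metis (no_types, opaque_lifting) dvd_minus_iff minus_diff_eq diff_diff_eq2 diff_diff_eq add.commute)
    also have "\<dots> \<longleftrightarrow> rot n (int r - int c) = rot n k"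
      using n by (simp only: rot_eq_iff mod_eq_dvd_iff)
    finally show ?thesis
      by simp
  qed
  then show ?thesis
    unfolding homogeneous_component_def span_mat_unit cyc_int_pow[OF n] by meson
qed

definition diag_seq :: "nat \<Rightarrow> 'a mat \<Rightarrow> int \<Rightarrow> 'a" where
  "diag_seq n A r = A $$ (idx n r, idx n r)"

lemma periodic_diag_seq: "periodic n (diag_seq n A)"
  by (simp add: periodic_def diag_seq_def idx_def)

lemma neutral_component_iff:
  assumes "n \<ge> 1"
  shows "A \<in> neutral_component n \<longleftrightarrow>
    A \<in> carrier_mat n n \<and> (\<forall>r<n. \<forall>c<n. A $$ (r, c) \<noteq> 0 \<longrightarrow> c = r)"
  using homogeneous_component_rot[OF assms, of A 0] by (auto simp: cyclic_gp_simps rot_0)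

lemma diag_seq_inject:
  assumes n: "n \<ge> 1" and A: "A \<in> neutral_component n" and B: "B \<in> neutral_component n"
    and eq: "diag_seq n A = diag_seq n B"
  shows "A = B"
proof (rule eq_matI)
  fix i j assume "i < dim_row B" "j < dim_col B"
  then have ij: "i < n" "j < n"
    using B n by (auto simp: neutral_component_iff)
  show "A $$ (i, j) = B $$ (i, j)"
  proof (cases "i = j")
    case True
    then show ?thesis
      using fun_cong[OF eq, of "int i"] ij by (simp add: diag_seq_def)
  next
    case False
    then show ?thesis
      using A B n ij unfolding neutral_component_iff[OF n] by metis
  qed
qed (use A B n in \<open>auto simp: neutral_component_iff\<close>)

lemma diag_seq_perm_action_cyc:
  assumes n: "n \<ge> 1" and A: "A \<in> neutral_component n"
  shows "diag_seq n (perm_action n (cyc n) A) = (\<lambda>r. diag_seq n A (r - 1))"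
proof
  fix r
  let ?q = "idx n (r - 1)"
  have rot: "Suc (idx n r) = rot n 1 i \<longleftrightarrow> i = Suc ?q" if "i \<in> {1..n}" for i
  proof -
    obtain m where m: "i = Suc m" "m < n"
      using \<open>i \<in> {1..n}\<close> by (cases i) auto
    have "idx n r = idx n (int m + 1) \<longleftrightarrow> idx n (r - 1) = idx n (int m)"
      unfolding idx_eq_iff[OF n] mod_eq_dvd_iff by (simp add: algebra_simps)
    then show ?thesis
      using m by (auto simp: rot_Suc)
  qed
  let ?T = "\<lambda>p. case p of (i, j) \<Rightarrow> A $$ (i - 1, j - 1) \<cdot>\<^sub>m mat_unit n (rot n 1 i) (rot n 1 j)"
  have "diag_seq n (perm_action n (cyc n) A) r = (\<Sum>p\<in>{1..n} \<times> {1..n}. ?T p $$ (idx n r, idx n r))"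
    unfolding diag_seq_def perm_action_def cyc_eq_rot using n
    by (intro finsum_mat_index) auto
  also have "\<dots> = (\<Sum>p\<in>{1..n} \<times> {1..n}. if p = (Suc ?q, Suc ?q) then A $$ (?q, ?q) else 0)"
  proof (rule sum.cong)
    fix p :: "nat \<times> nat" assume "p \<in> {1..n} \<times> {1..n}"
    then obtain i j where p: "p = (i, j)" and i: "i \<in> {1..n}" and j: "j \<in> {1..n}"
      by blast
    have "?T p $$ (idx n r, idx n r) =
        A $$ (i - 1, j - 1) * (if i = Suc ?q \<and> j = Suc ?q then 1 else 0)"
      using n by (simp add: p mat_unit_index rot[OF i] rot[OF j] carrier_matD[OF mat_unit_carrier])
    then show "?T p $$ (idx n r, idx n r) = (if p = (Suc ?q, Suc ?q) then A $$ (?q, ?q) else 0)"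
      by (simp add: p)
  qed simp
  also have "\<dots> = A $$ (?q, ?q)"
    using n by (simp add: sum.delta Suc_le_eq)
  finally show "diag_seq n (perm_action n (cyc n) A) r = diag_seq n A (r - 1)"
    by (simp add: diag_seq_def)
qed

section \<open>Products of weighted cyclic shifts\<close>

abbreviation shift_component :: "nat \<Rightarrow> 'a::field mat set" where
  "shift_component n \<equiv> homogeneous_component n (cyc n)"

text \<open>
  A matrix of degree \<open>\<alpha>\<close> is determined by these entries, one for each row.
\<close>

definition weights :: "nat \<Rightarrow> 'a mat \<Rightarrow> int \<Rightarrow> 'a" where
  "weights n A r = A $$ (idx n r, idx n (r - 1))"

lemma shift_component_iff:
  assumes "n \<ge> 1"
  shows "A \<in> shift_component n \<longleftrightarrow>
    A \<in> carrier_mat n n \<and> (\<forall>r<n. \<forall>c<n. A $$ (r, c) \<noteq> 0 \<longrightarrow> c = idx n (int r - 1))"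
  unfolding cyc_eq_rot by (rule homogeneous_component_rot[OF assms])

lemma periodic_weights: "periodic n (weights n A)"
  by (simp add: periodic_def weights_def idx_def mod_simps)

definition shift_mat :: "nat \<Rightarrow> (int \<Rightarrow> 'a::field) \<Rightarrow> 'a mat" where
  "shift_mat n b = mat n n (\<lambda>(r, c). if c = idx n (int r - 1) then b (int r) else 0)"

lemma shift_mat_mem: "n \<ge> 1 \<Longrightarrow> shift_mat n b \<in> shift_component n"
  by (auto simp: shift_component_iff shift_mat_def split: if_splits)

lemma weights_shift_mat: "n \<ge> 1 \<Longrightarrow> periodic n b \<Longrightarrow> weights n (shift_mat n b) = b"
  by (rule ext) (simp add: weights_def shift_mat_def, simp add: int_idx periodic_def)

lemma evaluate_monomial_carrier:
  assumes "\<And>x. x \<in> set (letters w) \<Longrightarrow> a x \<in> carrier_mat n n"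
  shows "evaluate_monomial n a w \<in> carrier_mat n n"
proof -
  have "foldr (\<lambda>x P. a x * P) xs (1\<^sub>m n) \<in> carrier_mat n n"
    if "\<And>x. x \<in> set xs \<Longrightarrow> a x \<in> carrier_mat n n" for xs
    using that by (induction xs) (auto intro: mult_carrier_mat)
  then show ?thesis
    using assms by (simp add: evaluate_monomial_def)
qed

text \<open>
  Every factor of degree \<open>\<alpha>\<close> moves the row index back by one, so a single path contributes to each
  entry of the product, and the \<open>t\<close>-th factor contributes its weight at the row \<open>r - t\<close>.
\<close>

lemma evaluate_monomial_shifts:
  fixes a :: "'x \<Rightarrow> 'a::field mat"
  assumes n: "n \<ge> 1" and a: "\<And>x. x \<in> set (letters w) \<Longrightarrow> a x \<in> shift_component n" and j: "j < n"
  shows "evaluate_monomial n a w $$ (idx n r, j) =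
    (if j = idx n (r - int (length (letters w)))
     then \<Prod>t<length (letters w). weights n (a (letters w ! t)) (r - int t) else 0)"
proof -
  have "foldr (\<lambda>x P. a x * P) xs (1\<^sub>m n) $$ (idx n r, j) =
    (if j = idx n (r - int (length xs)) then \<Prod>t<length xs. weights n (a (xs ! t)) (r - int t) else 0)"
    if "\<And>x. x \<in> set xs \<Longrightarrow> a x \<in> shift_component n" for xs
    using that
  proof (induction xs arbitrary: r)
    case Nil
    show ?case
      using n j by (auto simp: one_mat_def)
  next
    case (Cons x xs)
    let ?P = "foldr (\<lambda>x P. a x * P) xs (1\<^sub>m n)"
    have x: "a x \<in> carrier_mat n n"
      using Cons.prems[of x] by (simp add: shift_component_iff[OF n])
    have supp: "a x $$ (idx n r, c) = 0" if "c < n" "c \<noteq> idx n (r - 1)" for c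
    proof -
      have "a x $$ (idx n r, c) \<noteq> 0 \<longrightarrow> c = idx n (int (idx n r) - 1)"
        using Cons.prems[of x] n that(1) by (simp add: shift_component_iff del: idx_idx_diff)
      then show ?thesis
        using n that(2) by auto
    qed
    have P: "?P \<in> carrier_mat n n"
      using evaluate_monomial_carrier[of "Monomial xs" a n] Cons.prems n
      by (simp add: evaluate_monomial_def shift_component_iff)
    have "(a x * ?P) $$ (idx n r, j) = (\<Sum>c<n. a x $$ (idx n r, c) * ?P $$ (c, j))"
      using x P j n by (simp add: scalar_prod_def atLeast0LessThan)
    also have "\<dots> = (\<Sum>c<n. if c = idx n (r - 1) then weights n (a x) r * ?P $$ (idx n (r - 1), j) else 0)"
      by (rule sum.cong) (use supp in \<open>auto simp: weights_def\<close>)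
    also have "\<dots> = weights n (a x) r * ?P $$ (idx n (r - 1), j)"
      using n by (simp add: sum.delta)
    also have "\<dots> = (if j = idx n (r - int (length (x # xs)))
        then \<Prod>t<length (x # xs). weights n (a ((x # xs) ! t)) (r - int t) else 0)"
      using Cons.IH[of "r - 1"] Cons.prems
      by (simp add: prod.lessThan_Suc_shift algebra_simps del: prod.lessThan_Suc)
    finally show ?case
      by simp
  qed
  then show ?thesis
    using a by (simp add: evaluate_monomial_def)
qed

section \<open>Combinations of cyclically rotated words\<close>

text \<open>
  The word \<open>x\<^bsub>1-k\<^esub> x\<^bsub>2-k\<^esub> \<dots> x\<^bsub>n-k\<^esub>\<close> with indices read modulo \<open>n\<close>. The rotation is to the right
  so that the word takes the value of \<open>x\<^sub>1 \<dots> x\<^sub>n\<close> shifted by \<open>+k\<close>, as in the terms of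
  \<open>cyclic_conv\<close>.
\<close>

definition word :: "nat \<Rightarrow> nat \<Rightarrow> gvar monomial" where
  "word n k = Monomial (map (\<lambda>t. (Suc (idx n (int t - int k)), cyc n)) [0..<n])"

lemma bij_betw_idx:
  assumes n: "n \<ge> 1"
  shows "bij_betw (\<lambda>t. idx n (int t - k)) {..<n} {..<n}"
proof -
  have "inj_on (\<lambda>t. idx n (int t - k)) {..<n}"
  proof (rule inj_onI)
    fix s t assume st: "s \<in> {..<n}" "t \<in> {..<n}" "idx n (int s - k) = idx n (int t - k)"
    then have "int n dvd int s - int t"
      using n by (simp add: idx_eq_iff mod_eq_dvd_iff)
    then have "idx n (int s) = idx n (int t)"
      by (simp only: idx_eq_iff[OF n] mod_eq_dvd_iff)
    then show "s = t"
      using st(1,2) by simp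
  qed
  moreover have "(\<lambda>t. idx n (int t - k)) ` {..<n} \<subseteq> {..<n}"
    using n by auto
  ultimately show ?thesis
    by (simp add: bij_betw_def endo_inj_surj)
qed

lemma length_word [simp]: "length (letters (word n k)) = n"
  by (simp add: word_def)

lemma set_word:
  assumes "n \<ge> 1"
  shows "set (letters (word n k)) = {(i, cyc n) | i. i \<in> {1..n}}"
proof -
  have "set (letters (word n k)) = (\<lambda>t. (Suc t, cyc n)) ` (\<lambda>t. idx n (int t - int k)) ` {..<n}"
    by (auto simp: word_def)
  also have "\<dots> = (\<lambda>i. (i, cyc n)) ` Suc ` {..<n}"
    using bij_betw_idx[OF assms, of "int k"] by (simp add: bij_betw_def image_image)
  also have "Suc ` {..<n} = {1..n}"
    by (simp add: image_Suc_lessThan)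
  finally show ?thesis
    by auto
qed

lemma distinct_word: "n \<ge> 1 \<Longrightarrow> distinct (letters (word n k))"
  using bij_betw_idx[of n "int k"]
  by (auto simp: word_def distinct_map bij_betw_def inj_on_def)

text \<open>
  The first letters already differ. Distinctness of the words is what makes \<open>v k\<close> the coefficient of
  the \<open>k\<close>-th word in \<open>cyclic_poly\<close> below.
\<close>

lemma inj_on_word:
  assumes n: "n \<ge> 1"
  shows "inj_on (word n) {..<n}"
proof (rule inj_onI)
  fix k l assume kl: "k \<in> {..<n}" "l \<in> {..<n}" "word n k = word n l"
  then have "letters (word n k) ! 0 = letters (word n l) ! 0"
    by simp
  then have "idx n (- int k) = idx n (- int l)"
    using n by (simp add: word_def)
  then have "int n dvd int l - int k"
    using n by (simp add: idx_eq_iff mod_eq_dvd_iff)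
  then have "idx n (int l) = idx n (int k)"
    by (simp only: idx_eq_iff[OF n] mod_eq_dvd_iff)
  then show "k = l"
    using kl(1,2) by simp
qed

definition cyclic_poly :: "nat \<Rightarrow> (int \<Rightarrow> 'a::field) \<Rightarrow> (gvar, 'a) free_algebra" where
  "cyclic_poly n v = (\<Sum>k<n. Poly_Mapping.single (word n k) (v (int k)))"

lemma keys_cyclic_poly: "Poly_Mapping.keys (cyclic_poly n v) \<subseteq> word n ` {..<n}"
proof -
  have "Poly_Mapping.keys (cyclic_poly n v) \<subseteq>
      (\<Union>k<n. Poly_Mapping.keys (Poly_Mapping.single (word n k) (v (int k))))"
    unfolding cyclic_poly_def by (rule Poly_Mapping.keys_sum)
  also have "\<dots> \<subseteq> word n ` {..<n}"
    by (auto split: if_splits)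
  finally show ?thesis .
qed

lemma lookup_cyclic_poly:
  assumes "n \<ge> 1" "k < n"
  shows "Poly_Mapping.lookup (cyclic_poly n v) (word n k) = v (int k)"
proof -
  have "word n l = word n k \<longleftrightarrow> l = k" if "l < n" for l
    using inj_on_word[OF assms(1)] that assms(2) by (auto simp: inj_on_def)
  then have "Poly_Mapping.lookup (cyclic_poly n v) (word n k) = (\<Sum>l<n. if l = k then v (int k) else 0)"
    unfolding cyclic_poly_def lookup_sum lookup_single by (intro sum.cong) (auto simp: when_def)
  then show ?thesis
    using assms(2) by (simp add: sum.delta)
qed

text \<open>
  The diagonal of the value of the unrotated word \<open>x\<^sub>1 \<dots> x\<^sub>n\<close>.
\<close>

definition prod_seq :: "nat \<Rightarrow> (gvar \<Rightarrow> 'a::field mat) \<Rightarrow> int \<Rightarrow> 'a" where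
  "prod_seq n a r = (\<Prod>t<n. weights n (a (Suc t, cyc n)) (r - int t))"

lemma periodic_prod_seq: "periodic n (prod_seq n a)"
  unfolding periodic_def prod_seq_def
  by (intro allI prod.cong refl periodic_cong[OF periodic_weights]) (simp add: mod_simps)

text \<open>
  Position \<open>t\<close> of the rotated word holds the letter of position \<open>t - k\<close> of \<open>x\<^sub>1 \<dots> x\<^sub>n\<close>, with its
  weight taken at \<open>r - t = (r - k) - (t - k)\<close>. Hence the factors are those of \<open>x\<^sub>1 \<dots> x\<^sub>n\<close> at
  \<open>r - k\<close>, in another order.
\<close>

lemma evaluate_word:
  fixes a :: "gvar \<Rightarrow> 'a::field mat"
  assumes n: "n \<ge> 1" and a: "\<And>i. i \<in> {1..n} \<Longrightarrow> a (i, cyc n) \<in> shift_component n" and j: "j < n"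
  shows "evaluate_monomial n a (word n k) $$ (idx n r, j) =
    (if j = idx n r then prod_seq n a (r - int k) else 0)"
proof -
  have "a x \<in> shift_component n" if "x \<in> set (letters (word n k))" for x
    using that a set_word[OF n] by auto
  then have "evaluate_monomial n a (word n k) $$ (idx n r, j) =
      (if j = idx n (r - int n)
       then \<Prod>t<n. weights n (a (letters (word n k) ! t)) (r - int t) else 0)"
    using evaluate_monomial_shifts[OF n, of "word n k" a j r] j by simp
  also have "idx n (r - int n) = idx n r"
    by (simp add: idx_def)
  also have "(\<Prod>t<n. weights n (a (letters (word n k) ! t)) (r - int t)) =
      (\<Prod>t<n. weights n (a (Suc (idx n (int t - int k)), cyc n))
         (r - int k - int (idx n (int t - int k))))"
  proof (rule prod.cong)
    fix t assume t: "t \<in> {..<n}"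
    have "(r - int t) mod int n = (r - int k - int (idx n (int t - int k))) mod int n"
      using n by (simp add: int_idx mod_simps)
    then have "weights n A (r - int t) = weights n A (r - int k - int (idx n (int t - int k)))"
      for A :: "'a mat"
      by (rule periodic_cong[OF periodic_weights])
    then show "weights n (a (letters (word n k) ! t)) (r - int t) =
        weights n (a (Suc (idx n (int t - int k)), cyc n)) (r - int k - int (idx n (int t - int k)))"
      using t by (simp add: word_def)
  qed simp
  also have "\<dots> = prod_seq n a (r - int k)"
    unfolding prod_seq_def using bij_betw_idx[OF n, of "int k"]
    by (rule prod.reindex_bij_betw)
  finally show ?thesis .
qed

lemma evaluate_cyclic_poly:
  fixes a :: "gvar \<Rightarrow> 'a::field mat"
  assumes n: "n \<ge> 1" and a: "\<And>i. i \<in> {1..n} \<Longrightarrow> a (i, cyc n) \<in> shift_component n"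
  shows "evaluate n a (cyclic_poly n v) \<in> neutral_component n"
    and "diag_seq n (evaluate n a (cyclic_poly n v)) = cyclic_conv n v (prod_seq n a)"
proof -
  let ?f = "cyclic_poly n v"
  let ?E = "evaluate n a ?f"
  have carr: "evaluate_monomial n a (word n k) \<in> carrier_mat n n" for k
    using a n set_word[OF n, of k]
    by (intro evaluate_monomial_carrier) (auto simp: shift_component_iff)
  have carr_keys: "Poly_Mapping.lookup ?f w \<cdot>\<^sub>m evaluate_monomial n a w \<in> carrier_mat n n"
    if "w \<in> Poly_Mapping.keys ?f" for w
    using that keys_cyclic_poly carr by (metis imageE smult_carrier_mat subsetD)
  have E_carr: "?E \<in> carrier_mat n n"
    unfolding evaluate_def by (rule finsum_mat_closed) (rule carr_keys)
  have entry: "?E $$ (idx n r, j) = (if j = idx n r then cyclic_conv n v (prod_seq n a) r else 0)"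
    if j: "j < n" for r j
  proof -
    have "?E $$ (idx n r, j) = (\<Sum>w\<in>Poly_Mapping.keys ?f.
        (Poly_Mapping.lookup ?f w \<cdot>\<^sub>m evaluate_monomial n a w) $$ (idx n r, j))"
      unfolding evaluate_def using n j carr_keys by (intro finsum_mat_index) auto
    also have "\<dots> = (\<Sum>w\<in>Poly_Mapping.keys ?f.
        Poly_Mapping.lookup ?f w * evaluate_monomial n a w $$ (idx n r, j))"
    proof (rule sum.cong)
      fix w assume "w \<in> Poly_Mapping.keys ?f"
      then have "evaluate_monomial n a w \<in> carrier_mat n n"
        using keys_cyclic_poly carr by blast
      then show "(Poly_Mapping.lookup ?f w \<cdot>\<^sub>m evaluate_monomial n a w) $$ (idx n r, j) =
          Poly_Mapping.lookup ?f w * evaluate_monomial n a w $$ (idx n r, j)"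
        using n j by simp
    qed simp
    also have "\<dots> = (\<Sum>w\<in>word n ` {..<n}.
        Poly_Mapping.lookup ?f w * evaluate_monomial n a w $$ (idx n r, j))"
      by (rule sum.mono_neutral_left) (use keys_cyclic_poly in \<open>auto simp: in_keys_iff\<close>)
    also have "\<dots> = (\<Sum>k<n. v (int k) * (if j = idx n r then prod_seq n a (r - int k) else 0))"
    proof -
      have "evaluate_monomial n a (word n k) $$ (idx n r, j) =
          (if j = idx n r then prod_seq n a (r - int k) else 0)" for k
        using n a j by (rule evaluate_word)
      then show ?thesis
        using n by (simp add: sum.reindex inj_on_word lookup_cyclic_poly)
    qed
    finally show ?thesis
      by (simp add: cyclic_conv_def)
  qed
  have "c = r" if "r < n" "c < n" "?E $$ (r, c) \<noteq> 0" for r c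
    using entry[of c "int r"] that by (auto split: if_splits)
  then show "?E \<in> neutral_component n"
    using E_carr by (simp add: neutral_component_iff[OF n])
  show "diag_seq n ?E = cyclic_conv n v (prod_seq n a)"
    by (rule ext) (simp add: diag_seq_def entry[OF idx_less[OF n]])
qed

text \<open>
  Give the first shift the weights \<open>d\<close> and the others the constant weight 1.
\<close>

lemma prod_seq_surj:
  assumes n: "n \<ge> 1" and d: "periodic n d"
  shows "\<exists>a :: gvar \<Rightarrow> 'a::field mat. (\<forall>i. a (i, cyc n) \<in> shift_component n) \<and> prod_seq n a = d"
proof -
  define a :: "gvar \<Rightarrow> 'a mat" where
    "a x = shift_mat n (if fst x = 1 then d else (\<lambda>_. 1))" for x
  have w: "weights n (a (Suc t, cyc n)) = (if t = 0 then d else (\<lambda>_. 1))" for t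
    using n d by (simp add: a_def weights_shift_mat periodic_def)
  have "prod_seq n a r = d r" for r
  proof -
    have "prod_seq n a r = (\<Prod>t<n. if t = 0 then d r else 1)"
      unfolding prod_seq_def w by (rule prod.cong) auto
    then show ?thesis
      using n by (simp add: prod.delta)
  qed
  then have "prod_seq n a = d"
    by (rule ext)
  moreover have "a (i, cyc n) \<in> shift_component n" for i
    using n by (simp add: a_def shift_mat_mem)
  ultimately show ?thesis
    by blast
qed

lemma graded_image_cyclic_poly:
  fixes v :: "int \<Rightarrow> 'a::field"
  assumes n: "n \<ge> 1"
  shows "graded_image n n (\<lambda>_. cyc n) (cyclic_poly n v) =
    {A \<in> neutral_component n. diag_seq n A \<in> {cyclic_conv n v d | d. periodic n d}}"
proof (intro equalityI subsetI)
  fix A assume "A \<in> graded_image n n (\<lambda>_. cyc n) (cyclic_poly n v)"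
  then obtain a where a: "\<And>i. i \<in> {1..n} \<Longrightarrow> a (i, cyc n) \<in> shift_component n"
    and A: "A = evaluate n a (cyclic_poly n v)"
    unfolding graded_image_def by blast
  show "A \<in> {A \<in> neutral_component n. diag_seq n A \<in> {cyclic_conv n v d | d. periodic n d}}"
    using evaluate_cyclic_poly[OF n, of a v, OF a] periodic_prod_seq[of n a] unfolding A by blast
next
  fix A assume "A \<in> {A \<in> neutral_component n. diag_seq n A \<in> {cyclic_conv n v d | d. periodic n d}}"
  then obtain d where A: "A \<in> neutral_component n" "diag_seq n A = cyclic_conv n v d"
    and d: "periodic n d"
    by blast
  obtain a :: "gvar \<Rightarrow> 'a mat" where a: "\<And>i. a (i, cyc n) \<in> shift_component n" "prod_seq n a = d"
    using prod_seq_surj[OF n d] by blast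
  have "A = evaluate n a (cyclic_poly n v)"
    using diag_seq_inject[OF n A(1)] evaluate_cyclic_poly[OF n, of a v, OF a(1)] A(2) a(2) by simp
  then show "A \<in> graded_image n n (\<lambda>_. cyc n) (cyclic_poly n v)"
    using a(1) by (auto simp: graded_image_def)
qed

theorem theorem6:
  fixes n :: nat and V :: "'a::field mat set"
  assumes "n \<ge> 1"
    and "CHAR('a) = 0 \<or> \<not> CHAR('a) dvd n"
    and "cyclic_submodule n V (neutral_component n)"
  shows "\<exists>(f :: (gvar, 'a) free_algebra) m \<tau>.
           m \<ge> 1 \<and> (\<forall>i\<in>{1..m}. \<tau> i \<in> carrier (cyclic_gp n)) \<and>
           f \<in> free_graded_algebra n \<and> multilinear m \<tau> f \<and> graded_image n m \<tau> f = V"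
proof -
  note n = assms(1)
  have V: "V \<subseteq> neutral_component n" and sub: "submodule class_ring V (mat_space n)"
    and act: "\<And>A. A \<in> V \<Longrightarrow> perm_action n (cyc n) A \<in> V"
    using assms(3) cyclic_gp_simps(3)
    by (auto simp: cyclic_submodule_def VectorSpace.subspace_def)
  have carr: "A \<in> carrier_mat n n" if "A \<in> V" for A
    using that V by (auto simp: neutral_component_iff[OF n])
  have zero: "(\<lambda>_. 0) \<in> diag_seq n ` V"
  proof
    show "0\<^sub>m n n \<in> V"
      using submodule.zero_closed[OF sub] by (simp add: mat_space_simps)
    show "(\<lambda>_. 0) = diag_seq n (0\<^sub>m n n :: 'a mat)"
      using n by (auto simp: diag_seq_def)
  qed
  have add: "(\<lambda>r. d r + e r) \<in> diag_seq n ` V" if de: "d \<in> diag_seq n ` V" "e \<in> diag_seq n ` V" for d e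
  proof -
    obtain A B where AB: "A \<in> V" "B \<in> V" "d = diag_seq n A" "e = diag_seq n B"
      using de by blast
    have "A + B \<in> V"
      using submodule.m_closed[OF sub AB(1,2)] by (simp add: mat_space_simps)
    moreover have "(\<lambda>r. d r + e r) = diag_seq n (A + B)"
      using n carr[OF AB(1)] carr[OF AB(2)] by (auto simp: AB(3,4) diag_seq_def)
    ultimately show ?thesis
      by blast
  qed
  have scale: "(\<lambda>r. c * d r) \<in> diag_seq n ` V" if d: "d \<in> diag_seq n ` V" for c d
  proof -
    obtain A where A: "A \<in> V" "d = diag_seq n A"
      using d by blast
    have "c \<cdot>\<^sub>m A \<in> V"
      using submodule.smult_closed[OF sub _ A(1), of c] by (simp add: mat_space_simps)
    moreover have "(\<lambda>r. c * d r) = diag_seq n (c \<cdot>\<^sub>m A)"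
      using n carr[OF A(1)] by (auto simp: A(2) diag_seq_def)
    ultimately show ?thesis
      by blast
  qed
  have shift: "(\<lambda>r. d (r - 1)) \<in> diag_seq n ` V" if d: "d \<in> diag_seq n ` V" for d
  proof -
    obtain A where A: "A \<in> V" "d = diag_seq n A"
      using d by blast
    then have "(\<lambda>r. d (r - 1)) = diag_seq n (perm_action n (cyc n) A)"
      using diag_seq_perm_action_cyc[OF n, of A] V by auto
    then show ?thesis
      using act[OF A(1)] by blast
  qed
  obtain v where v: "diag_seq n ` V = {cyclic_conv n v d | d. periodic n d}"
    by (rule cyclic_code_generator[OF n _ zero add scale shift]) (use periodic_diag_seq in auto)
  have word: "distinct (letters w) \<and> set (letters w) = {(i, cyc n) | i. i \<in> {1..n}}"
    if w: "w \<in> Poly_Mapping.keys (cyclic_poly n v)" for w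
  proof -
    obtain k where "w = word n k"
      using keys_cyclic_poly[of n v] w by blast
    then show ?thesis
      using set_word[OF n] distinct_word[OF n] by simp
  qed
  have "graded_image n n (\<lambda>_. cyc n) (cyclic_poly n v) = V"
    unfolding graded_image_cyclic_poly[OF n] v[symmetric]
    using V diag_seq_inject[OF n] by blast
  moreover have "multilinear n (\<lambda>_. cyc n) (cyclic_poly n v)"
    and "cyclic_poly n v \<in> free_graded_algebra n"
    using word cyclic_gp_simps(3)[of n]
    by (auto simp: multilinear_def free_graded_algebra_def graded_vars_def)
  ultimately show ?thesis
    using n cyclic_gp_simps(3)[of n]
    by (intro exI[of _ "cyclic_poly n v"] exI[of _ n] exI[of _ "\<lambda>_. cyc n"]) simp
qed

end
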